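(* Let $F_n$ be the free group on $n$ generators and let $w_1, w_2 \in F_n$. Then $w_1$ and $w_2$ are endomorphic equivalent in $F_n$ if and only if $G_{w_1} = G_{w_2}$ for every group $G$.
   Context: $F_n = \langle x_1,\dots,x_n\rangle$ is the free group on $n$ generators. For $w\in F_n$ and a group $G$, the word map $w: G^{(n)}\to G$ (where $G^{(n)}$ is the direct product of $n$ copies of $G$) sends $(g_1,\dots,g_n)$ to $w(g_1,\dots,g_n)$, the element obtained by substituting $g_i$ for $x_i$ in $w$; its image is denoted $G_w$. Equivalently, $G_w=\{\phi(w)\mid \phi\in \mathrm{Hom}(F_n,G)\}$. Two elements $g,h$ of a group $H$ are endomorphic equivalent if there exist endomorphisms $\phi_1,\phi_2$ of $H$ (not necessarily distinct) with $\phi_1(g)=h$ and $\phi_2(h)=g$. *)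

theory Defs
  imports "HOL-Algebra.Product_Groups"
begin

text \<open>The pair \<open>(i, True)\<close> stands for \<open>x\<^sub>i\<close> and \<open>(i, False)\<close> for its inverse.\<close>

type_synonym letter = "nat \<times> bool"

definition inv_letter :: "letter \<Rightarrow> letter" where
  "inv_letter a = (fst a, \<not> snd a)"

definition reduced :: "letter list \<Rightarrow> bool" where
  "reduced w \<longleftrightarrow> successively (\<lambda>a b. b \<noteq> inv_letter a) w"

fun cons_cancel :: "letter \<Rightarrow> letter list \<Rightarrow> letter list" where
  "cons_cancel a [] = [a]"
| "cons_cancel a (b # w) = (if b = inv_letter a then w else a # b # w)"

text \<open>A product is computed by prepending the letters of the left factor one at a time, from its
  last to its first, cancelling against the head of the word on the right.\<close>

definition free_group :: "nat \<Rightarrow> letter list monoid" where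
  "free_group n =
     \<lparr>carrier = {w. reduced w \<and> fst ` set w \<subseteq> {1..n}},
      monoid.mult = (\<lambda>u v. foldr cons_cancel u v),
      one = []\<rparr>"

definition word_map :: "('a, 'b) monoid_scheme \<Rightarrow> letter list \<Rightarrow> (nat \<Rightarrow> 'a) \<Rightarrow> 'a" where
  "word_map G w g =
     foldr (\<lambda>(i, e) a. (if e then g i else inv\<^bsub>G\<^esub> g i) \<otimes>\<^bsub>G\<^esub> a) w \<one>\<^bsub>G\<^esub>"

definition word_image :: "('a, 'b) monoid_scheme \<Rightarrow> nat \<Rightarrow> letter list \<Rightarrow> 'a set" where
  "word_image G n w = word_map G w ` carrier (product_group {1..n} (\<lambda>_. G))"

definition endomorphic_equivalent :: "('a, 'b) monoid_scheme \<Rightarrow> 'a \<Rightarrow> 'a \<Rightarrow> bool" where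
  "endomorphic_equivalent H g h \<longleftrightarrow>
     (\<exists>\<phi>\<^sub>1 \<in> hom H H. \<exists>\<phi>\<^sub>2 \<in> hom H H. \<phi>\<^sub>1 g = h \<and> \<phi>\<^sub>2 h = g)"


text \<open>The reduced words form a group with the universal property of the free group on
  \<open>x\<^sub>1, \<dots>, x\<^sub>n\<close>.\<close>

lemma inv_letter_inv_letter [simp]: "inv_letter (inv_letter a) = a"
  by (simp add: inv_letter_def)

lemma inv_letter_neq [simp]: "inv_letter a \<noteq> a" "a \<noteq> inv_letter a"
  by (auto simp: inv_letter_def prod_eq_iff)

lemma fst_inv_letter [simp]: "fst (inv_letter a) = fst a"
  by (simp add: inv_letter_def)

lemma reduced_Nil [simp]: "reduced []"
  by (simp add: reduced_def)

lemma reduced_Cons: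
  "reduced (a # w) \<longleftrightarrow> reduced w \<and> (w = [] \<or> hd w \<noteq> inv_letter a)"
  by (cases w) (auto simp: reduced_def)

lemma reduced_cons_cancel: "reduced w \<Longrightarrow> reduced (cons_cancel a w)"
  by (cases w) (auto simp: reduced_Cons)

lemma cons_cancel_inv [simp]:
  "reduced w \<Longrightarrow> cons_cancel a (cons_cancel (inv_letter a) w) = w"
  by (cases w; cases "tl w") (auto simp: reduced_Cons)

lemma reduced_foldr: "reduced v \<Longrightarrow> reduced (foldr cons_cancel u v)"
  by (induction u) (auto intro: reduced_cons_cancel)

lemma set_cons_cancel: "set (cons_cancel a w) \<subseteq> insert a (set w)"
  by (cases w) auto

lemma set_foldr_cons_cancel: "set (foldr cons_cancel u v) \<subseteq> set u \<union> set v"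
proof (induction u)
  case (Cons a u)
  then show ?case
    using set_cons_cancel[of a "foldr cons_cancel u v"] by auto
qed simp

lemma foldr_cons_cancel_left:
  assumes "reduced w"
  shows "foldr cons_cancel (cons_cancel a u) w = cons_cancel a (foldr cons_cancel u w)"
  using assms by (cases u) (auto simp: reduced_foldr)

lemma foldr_cons_cancel_assoc:
  assumes "reduced w"
  shows "foldr cons_cancel (foldr cons_cancel u v) w = foldr cons_cancel u (foldr cons_cancel v w)"
  using assms by (induction u) (auto simp: foldr_cons_cancel_left)

lemma foldr_cons_cancel_Nil: "reduced u \<Longrightarrow> foldr cons_cancel u [] = u"
proof (induction u)
  case (Cons a u)
  then show ?case by (cases u) (auto simp: reduced_Cons)
qed simp

lemma foldr_cons_cancel_rev_inv:
  "foldr cons_cancel (rev (map inv_letter u)) (foldr cons_cancel u []) = []"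
proof (induction u)
  case (Cons a u)
  have "cons_cancel (inv_letter a) (cons_cancel a (foldr cons_cancel u [])) = foldr cons_cancel u []"
    using cons_cancel_inv[of "foldr cons_cancel u []" "inv_letter a"] by (simp add: reduced_foldr)
  with Cons show ?case by simp
qed simp

lemma group_free_group: "group (free_group n)"
proof (rule groupI)
  fix u v assume "u \<in> carrier (free_group n)" "v \<in> carrier (free_group n)"
  then show "u \<otimes>\<^bsub>free_group n\<^esub> v \<in> carrier (free_group n)"
    using set_foldr_cons_cancel[of u v] by (fastforce simp: free_group_def reduced_foldr)
next
  fix u assume u: "u \<in> carrier (free_group n)"
  let ?v = "foldr cons_cancel (rev (map inv_letter u)) []"
  have "?v \<in> carrier (free_group n)"
    using u set_foldr_cons_cancel[of "rev (map inv_letter u)" "[]"]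
    by (fastforce simp: free_group_def reduced_foldr)
  moreover have "?v \<otimes>\<^bsub>free_group n\<^esub> u = \<one>\<^bsub>free_group n\<^esub>"
    using u foldr_cons_cancel_rev_inv[of u] 
    by (simp add: free_group_def foldr_cons_cancel_assoc foldr_cons_cancel_Nil)
  ultimately show "\<exists>v\<in>carrier (free_group n). v \<otimes>\<^bsub>free_group n\<^esub> u = \<one>\<^bsub>free_group n\<^esub>"
    by blast
qed (auto simp: free_group_def foldr_cons_cancel_assoc)

lemma word_map_Cons:
  "word_map G (a # w) g =
     (if snd a then g (fst a) else inv\<^bsub>G\<^esub> g (fst a)) \<otimes>\<^bsub>G\<^esub> word_map G w g"
  by (simp add: word_map_def split: prod.split)

lemma (in group) word_map_closed:
  assumes "\<And>i. i \<in> {1..n} \<Longrightarrow> g i \<in> carrier G" "fst ` set w \<subseteq> {1..n}"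
  shows "word_map G w g \<in> carrier G"
  using assms(2)
proof (induction w)
  case Nil
  then show ?case by (simp add: word_map_def)
next
  case (Cons a w)
  then show ?case using assms(1)[of "fst a"] by (auto simp: word_map_Cons)
qed

lemma (in group) word_map_cons_cancel:
  assumes g: "\<And>i. i \<in> {1..n} \<Longrightarrow> g i \<in> carrier G"
    and w: "fst ` set w \<subseteq> {1..n}" "fst a \<in> {1..n}"
  shows "word_map G (cons_cancel a w) g = word_map G (a # w) g"
proof (cases w)
  case (Cons b v)
  have "word_map G v g \<in> carrier G"
    using g w Cons by (intro word_map_closed[of n]) auto
  then show ?thesis
    using g[OF w(2)] Cons
    by (auto simp: word_map_Cons inv_letter_def m_assoc[symmetric])
qed simp

lemma (in group) word_map_hom:
  assumes g: "\<And>i. i \<in> {1..n} \<Longrightarrow> g i \<in> carrier G"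
  shows "(\<lambda>w. word_map G w g) \<in> hom (free_group n) G"
proof (rule homI)
  fix u assume "u \<in> carrier (free_group n)"
  then show "word_map G u g \<in> carrier G"
    using g by (auto simp: free_group_def intro!: word_map_closed[of n])
next
  fix u v assume "u \<in> carrier (free_group n)" and v: "v \<in> carrier (free_group n)"
  then have "fst ` set u \<subseteq> {1..n}" and v: "fst ` set v \<subseteq> {1..n}"
    by (auto simp: free_group_def)
  then have "word_map G (foldr cons_cancel u v) g = word_map G u g \<otimes> word_map G v g"
  proof (induction u)
    case Nil
    then show ?case
      using word_map_closed[of n g v] g by (simp add: word_map_def)
  next
    case (Cons a u)
    have "fst ` set (foldr cons_cancel u v) \<subseteq> {1..n}"
      using set_foldr_cons_cancel[of u v] Cons.prems by fastforce
    then have "word_map G (foldr cons_cancel (a # u) v) g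
               = word_map G (a # foldr cons_cancel u v) g"
      using word_map_cons_cancel[of n g] g Cons.prems by simp
    moreover have "word_map G u g \<in> carrier G" "word_map G v g \<in> carrier G"
      using g Cons.prems by (auto intro!: word_map_closed[of n])
    ultimately show ?case
      using Cons g[of "fst a"] by (auto simp: word_map_Cons m_assoc)
  qed
  then show "word_map G (u \<otimes>\<^bsub>free_group n\<^esub> v) g = word_map G u g \<otimes> word_map G v g"
    by (simp add: free_group_def)
qed

lemma generator_in_free_group: "i \<in> {1..n} \<Longrightarrow> [(i, e)] \<in> carrier (free_group n)"
  by (simp add: free_group_def reduced_Cons)

lemma inv_generator_free_group:
  assumes "i \<in> {1..n}"
  shows "inv\<^bsub>free_group n\<^esub> [(i, True)] = [(i, False)]"
proof (rule group.inv_equality[OF group_free_group])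
  show "[(i, False)] \<otimes>\<^bsub>free_group n\<^esub> [(i, True)] = \<one>\<^bsub>free_group n\<^esub>"
    by (simp add: free_group_def inv_letter_def)
qed (use assms in \<open>auto intro: generator_in_free_group\<close>)

lemma hom_free_group_eq_word_map:
  assumes "group G" and \<phi>: "\<phi> \<in> hom (free_group n) G" and "w \<in> carrier (free_group n)"
  shows "\<phi> w = word_map G w (\<lambda>i. \<phi> [(i, True)])"
proof -
  interpret F: group "free_group n" by (rule group_free_group)
  interpret G: group G by fact
  interpret group_hom "free_group n" G \<phi>
    by unfold_locales (rule \<phi>)
  show ?thesis
    using assms(3)
  proof (induction w)
    case Nil
    have "\<phi> \<one>\<^bsub>free_group n\<^esub> = \<one>\<^bsub>G\<^esub>" by simp
    then show ?case by (simp add: free_group_def word_map_def)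
  next
    case (Cons a w)
    have a: "fst a \<in> {1..n}" and w: "w \<in> carrier (free_group n)"
      using Cons.prems by (auto simp: free_group_def reduced_Cons)
    have "a # w = [a] \<otimes>\<^bsub>free_group n\<^esub> w"
      using Cons.prems by (cases w) (auto simp: free_group_def reduced_Cons)
    then have "\<phi> (a # w) = \<phi> [a] \<otimes>\<^bsub>G\<^esub> \<phi> w"
      using w a generator_in_free_group[of "fst a" n "snd a"] by simp
    moreover have "\<phi> [a] = (if snd a then \<phi> [(fst a, True)] else inv\<^bsub>G\<^esub> \<phi> [(fst a, True)])"
      using hom_inv[OF generator_in_free_group[OF a, of True]] inv_generator_free_group[OF a]
      by (cases a) auto
    ultimately show ?case
      using Cons.IH[OF w] by (simp add: word_map_Cons)
  qed
qed

theorem free_group_universal: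
  assumes "group G" and g: "\<And>i. i \<in> {1..n} \<Longrightarrow> g i \<in> carrier G"
  shows "\<exists>\<phi> \<in> hom (free_group n) G. \<forall>i \<in> {1..n}. \<phi> [(i, True)] = g i"
    and "\<lbrakk>\<phi> \<in> hom (free_group n) G; \<psi> \<in> hom (free_group n) G;
          \<forall>i \<in> {1..n}. \<phi> [(i, True)] = \<psi> [(i, True)]; w \<in> carrier (free_group n)\<rbrakk>
         \<Longrightarrow> \<phi> w = \<psi> w"
proof -
  interpret group G by fact
  show "\<exists>\<phi> \<in> hom (free_group n) G. \<forall>i \<in> {1..n}. \<phi> [(i, True)] = g i"
    using word_map_hom[of n g] g
    by (intro bexI[of _ "\<lambda>w. word_map G w g"]) (auto simp: word_map_def)
next
  assume \<phi>: "\<phi> \<in> hom (free_group n) G" and \<psi>: "\<psi> \<in> hom (free_group n) G"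
    and eq: "\<forall>i \<in> {1..n}. \<phi> [(i, True)] = \<psi> [(i, True)]"
    and w: "w \<in> carrier (free_group n)"
  have "word_map G w (\<lambda>i. \<phi> [(i, True)]) = word_map G w (\<lambda>i. \<psi> [(i, True)])"
    unfolding word_map_def using w eq by (intro foldr_cong) (force simp: free_group_def)+
  then show "\<phi> w = \<psi> w"
    using hom_free_group_eq_word_map[OF assms(1) \<phi> w] hom_free_group_eq_word_map[OF assms(1) \<psi> w]
    by simp
qed

end

theory Submission
  imports Defs "HOL-Algebra.Weak_Morphisms" "HOL-Library.Countable"
begin

text \<open>The word image of \<open>w\<close> in \<open>G\<close> consists of the values \<open>\<phi> w\<close> of the homomorphisms \<open>\<phi>\<close> from the
  free group to \<open>G\<close>, so precomposing with an endomorphism that sends \<open>w\<^sub>1\<close> to \<open>w\<^sub>2\<close> shows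
  \<open>G\<^sub>w\<^sub>2 \<subseteq> G\<^sub>w\<^sub>1\<close>. Conversely, take for \<open>G\<close> the free group itself: \<open>w\<^sub>1\<close> lies in its own word image,
  hence in that of \<open>w\<^sub>2\<close>. Being countable, the free group has a copy on every infinite type.\<close>

text \<open>Evaluation at a tuple is a homomorphism on words, and conversely every homomorphism is
  evaluation at its images of the generators.\<close>

lemma word_image_eq_hom_values:
  assumes "group G" and w: "w \<in> carrier (free_group n)"
  shows "word_image G n w = (\<lambda>\<phi>. \<phi> w) ` hom (free_group n) G"
proof (intro equalityI subsetI)
  fix x assume "x \<in> word_image G n w"
  then obtain g where "g \<in> carrier (product_group {1..n} (\<lambda>_. G))" and x: "x = word_map G w g"
    by (auto simp: word_image_def)
  then have "(\<lambda>u. word_map G u g) \<in> hom (free_group n) G"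
    by (intro group.word_map_hom[OF assms(1)]) (auto dest: PiE_mem)
  then show "x \<in> (\<lambda>\<phi>. \<phi> w) ` hom (free_group n) G"
    using x by (intro image_eqI) auto
next
  fix x assume "x \<in> (\<lambda>\<phi>. \<phi> w) ` hom (free_group n) G"
  then obtain \<phi> where \<phi>: "\<phi> \<in> hom (free_group n) G" and x: "x = \<phi> w"
    by auto
  \<comment> \<open>The product group contains only functions that are \<open>undefined\<close>
    outside \<open>{1..n}\<close>; restricting does not change the value, since the letters of
    \<open>w\<close> have indices in \<open>{1..n}\<close>.\<close>
  define g where "g = restrict (\<lambda>i. \<phi> [(i, True)]) {1..n}"
  have g: "g \<in> carrier (product_group {1..n} (\<lambda>_. G))"
    using hom_in_carrier[OF \<phi>] generator_in_free_group by (auto simp: g_def)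
  have "x = word_map G w (\<lambda>i. \<phi> [(i, True)])"
    using hom_free_group_eq_word_map[OF assms(1) \<phi> w] x by simp
  also have "\<dots> = word_map G w g"
    unfolding word_map_def using w
    by (intro foldr_cong) (force simp: g_def free_group_def)+
  finally show "x \<in> word_image G n w"
    using g by (auto simp: word_image_def)
qed

lemma word_image_endomorphism_subset:
  assumes "group G" and "w \<in> carrier (free_group n)"
    and \<psi>: "\<psi> \<in> hom (free_group n) (free_group n)"
  shows "word_image G n (\<psi> w) \<subseteq> word_image G n w"
proof -
  have "\<psi> w \<in> carrier (free_group n)"
    using assms by (auto intro: hom_in_carrier)
  moreover have "\<phi> (\<psi> w) \<in> (\<lambda>\<phi>. \<phi> w) ` hom (free_group n) G"
    if "\<phi> \<in> hom (free_group n) G" for \<phi>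
    using Group.hom_compose[OF \<psi> that] by (intro image_eqI[of _ _ "\<phi> \<circ> \<psi>"]) auto
  ultimately show ?thesis
    using assms by (auto simp: word_image_eq_hom_values)
qed

lemma word_image_eq_if_endomorphic_equivalent:
  assumes "group G" "w1 \<in> carrier (free_group n)" "w2 \<in> carrier (free_group n)"
    and "endomorphic_equivalent (free_group n) w1 w2"
  shows "word_image G n w1 = word_image G n w2"
  using assms word_image_endomorphism_subset unfolding endomorphic_equivalent_def
  by (metis subset_antisym)

text \<open>\<open>G\<close> is a copy of the free group, so a homomorphism into \<open>G\<close>
  followed by the inverse of \<open>f\<close> is an endomorphism.\<close>

lemma endomorphism_if_word_image_iso_subset:
  assumes "group G" and f: "f \<in> iso (free_group n) G"
    and w: "w1 \<in> carrier (free_group n)" "w2 \<in> carrier (free_group n)"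
    and sub: "word_image G n w2 \<subseteq> word_image G n w1"
  shows "\<exists>\<psi> \<in> hom (free_group n) (free_group n). \<psi> w1 = w2"
proof -
  let ?h = "inv_into (carrier (free_group n)) f"
  have inj: "inj_on f (carrier (free_group n))"
    using f by (auto simp: iso_def bij_betw_def)
  \<comment> \<open>The isomorphism \<open>f\<close> is itself one of the homomorphisms whose values
    at \<open>w2\<close> form the word image.\<close>
  have "f w2 \<in> word_image G n w2"
    using f assms(1) w by (auto simp: word_image_eq_hom_values iso_def)
  then obtain \<phi> where \<phi>: "\<phi> \<in> hom (free_group n) G" "f w2 = \<phi> w1"
    using sub assms(1) w by (auto simp: word_image_eq_hom_values)
  have "?h \<in> hom G (free_group n)"
    using group.iso_set_sym[OF group_free_group f] by (simp add: iso_def)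
  then have "?h \<circ> \<phi> \<in> hom (free_group n) (free_group n)"
    by (rule Group.hom_compose[OF \<phi>(1)])
  moreover have "(?h \<circ> \<phi>) w1 = w2"
    using inj w by (simp flip: \<phi>(2))
  ultimately show ?thesis
    by blast
qed

lemma infinite_type_countable_inj:
  assumes "infinite (UNIV :: 'a set)"
  obtains f :: "'b::countable \<Rightarrow> 'a" where "inj f"
proof -
  obtain h :: "nat \<Rightarrow> 'a" where "inj h"
    using infinite_countable_subset[OF assms] by blast
  then have "inj (h \<circ> (to_nat :: 'b \<Rightarrow> nat))"
    by (intro inj_compose) auto
  then show ?thesis
    by (rule that)
qed

text \<open>A HOL formula cannot quantify over groups of all types. Hence the equivalence is stated
  over one arbitrary infinite type \<open>'a\<close>, and the forward implication also over an
  arbitrary type \<open>'b\<close>.\<close>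

theorem lemma1p4:
  fixes n :: nat and w1 w2 :: "letter list"
  assumes "w1 \<in> carrier (free_group n)" and "w2 \<in> carrier (free_group n)"
    and "infinite (UNIV :: 'a set)"
  shows "(endomorphic_equivalent (free_group n) w1 w2 \<longleftrightarrow>
            (\<forall>G :: 'a monoid. group G \<longrightarrow> word_image G n w1 = word_image G n w2))
       \<and> (endomorphic_equivalent (free_group n) w1 w2 \<longrightarrow>
            (\<forall>G :: 'b monoid. group G \<longrightarrow> word_image G n w1 = word_image G n w2))"
proof -
  have converse: "endomorphic_equivalent (free_group n) w1 w2"
    if eq: "\<forall>G :: 'a monoid. group G \<longrightarrow> word_image G n w1 = word_image G n w2"
  proof -
    obtain f :: "letter list \<Rightarrow> 'a" where "inj f"
      using infinite_type_countable_inj[OF assms(3)] .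
    then have f: "inj_on f (carrier (free_group n))"
      by (rule inj_on_subset) simp
    \<comment> \<open>The multiplication of the free group is transported along \<open>f\<close> to
      the image of its carrier in \<open>'a\<close>.\<close>
    define G where "G = image_group f (free_group n)"
    have G: "group G"
      unfolding G_def by (rule group.inj_imp_image_group_is_group[OF group_free_group f])
    have iso: "f \<in> iso (free_group n) G"
      unfolding G_def by (rule inj_imp_image_group_iso[OF f])
    \<comment> \<open>Equality of the word images gives both inclusions, hence an endomorphism in
      each direction.\<close>
    show ?thesis
      unfolding endomorphic_equivalent_def
      using endomorphism_if_word_image_iso_subset[OF G iso] assms(1,2) eq G by simp
  qed
  show ?thesis
    by (intro conjI iffI impI allI)
      (simp_all add: converse word_image_eq_if_endomorphic_equivalent[OF _ assms(1,2)])
qed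

end
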